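(* Suppose that $(V,X,V^* )$ is a Gelfand triple with adjoint embedding $\mathcal{E}^*:X\to V^*$, and that there is a constant $K>0$ such that $\|Ax\|_Y\ge K\|\mathcal{E}^*x\|_{V^*}$ for all $x\in X$. Let $p>1$, let $y\in\mathcal{R}(A)$ and let $x^\dagger\in X$ be the unique solution of $Ax=y$. Suppose that the orthonormal basis $\{u_k\}_{k\in\mathbb{N}}$ of $X$ satisfies $u_k\in V$ for all $k\in\operatorname{supp}(x^\dagger)$ and that $\sum_{k=1}^\infty|\langle x^\dagger,u_k\rangle_X|<\infty$. Then there are a parameter choice $\alpha=\alpha(\delta,y^\delta)>0$ and a concave index function $\varphi$ such that $$\sum_{k=1}^\infty |\langle x_\alpha^\delta-x^\dagger,u_k\rangle_X| = \mathcal{O}(\varphi(\delta))\qquad\text{as }\delta\to 0,$$ i.e. there are constants $C,\bar\delta>0$ such that for all $0<\delta\le\bar\delta$, all $y^\delta\in Y$ with $\|y-y^\delta\|_Y\le\delta$, and every minimizer $x_\alpha^\delta$ over $X$ of $$T_\alpha^\delta(x)=\frac1p\|Ax-y^\delta\|_Y^p+\alpha\sum_{k=1}^\infty|\langle x,u_k\rangle_X|$$ with $\alpha=\alpha(\delta,y^\delta)$, the left-hand side is at most $C\varphi(\delta)$.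
   Context: $X$ is an infinite-dimensional separable real Hilbert space, $Y$ is a Banach space, and $A:X\to Y$ is a bounded injective linear operator with non-closed range. $(V,X,V^* )$ is called a Gelfand triple if $V$ is a separable linear subspace of $X$ with its own norm $\|\cdot\|_V$, dense in $X$, such that (1) the linear embedding $\mathcal{E}:V\to X$ is continuous, i.e. $\|\mathcal{E}v\|_X\le C_0\|v\|_V$ for all $v\in V$ with some constant $C_0>0$; (2) the duality pairing of $V$ and its dual $V^*$ satisfies $\langle x,v\rangle_{V^*\times V}=\langle x,v\rangle_X$ for all $x\in X$, $v\in V$, where $x\in X$ is regarded as an element of $V^*$ via the adjoint embedding $\mathcal{E}^*:X\to V^*$, so $\langle\mathcal{E}^*x,v\rangle_{V^*\times V}=\langle x,\mathcal{E}v\rangle_X$. For $x\in X$, $\operatorname{supp}(x)=\{k\in\mathbb{N}:\langle x,u_k\rangle_X\neq0\}$. The functional $T_\alpha^\delta$ takes values in $[0,\infty]$, and minimizers exist for all $\alpha>0$ and $y^\delta\in Y$. An index function is an increasing (i.e. non-decreasing) function $\varphi:(0,\infty)\to(0,\infty)$ with $\lim_{t\to+0}\varphi(t)=0$. *)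

theory Defs
  imports "HOL-Analysis.Analysis"
begin

text \<open>
  The space \<open>V\<close> with its own norm is represented by a real normed type \<open>'v\<close> together with an
  injective linear embedding \<open>E\<close> into \<open>'x\<close>; as a subspace of \<open>'x\<close> it is \<open>range E\<close>.
  The dual \<open>V\<^sup>*\<close> is the type \<open>'v \<Rightarrow>\<^sub>L real\<close> with the operator norm, and
  \<open>blinfun_apply\<close> is the duality pairing. The last conjunct determines \<open>E_adj\<close> uniquely.
\<close>
definition gelfand_triple ::
  "('v::real_normed_vector \<Rightarrow> 'x::real_inner) \<Rightarrow> ('x \<Rightarrow> 'v \<Rightarrow>\<^sub>L real) \<Rightarrow> bool"
  where "gelfand_triple E E_adj \<longleftrightarrow>
    linear E \<and> inj E \<and>
    separable_space (euclidean :: 'v topology) \<and>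
    closure (range E) = UNIV \<and>
    (\<exists>C0>0. \<forall>v. norm (E v) \<le> C0 * norm v) \<and>
    (\<forall>x v. blinfun_apply (E_adj x) v = x \<bullet> E v)"

definition orthonormal_basis :: "(nat \<Rightarrow> 'x::real_inner) \<Rightarrow> bool"
  where "orthonormal_basis u \<longleftrightarrow>
    (\<forall>i j. u i \<bullet> u j = (if i = j then 1 else 0)) \<and> closure (span (range u)) = UNIV"

definition supp :: "(nat \<Rightarrow> 'x::real_inner) \<Rightarrow> 'x \<Rightarrow> nat set"
  where "supp u x = {k. x \<bullet> u k \<noteq> 0}"

text \<open>Valued in \<open>[0,\<infinity>]\<close>, so that a divergent series has the value \<open>\<infinity>\<close>.\<close>
definition l1_norm :: "(nat \<Rightarrow> 'x::real_inner) \<Rightarrow> 'x \<Rightarrow> ennreal"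
  where "l1_norm u x = (\<Sum>k. ennreal \<bar>x \<bullet> u k\<bar>)"

definition tikhonov ::
  "('x::real_inner \<Rightarrow> 'y::real_normed_vector) \<Rightarrow> (nat \<Rightarrow> 'x) \<Rightarrow> real \<Rightarrow> real \<Rightarrow> 'y \<Rightarrow> 'x \<Rightarrow> ennreal"
  where "tikhonov A u p \<alpha> yd x =
    ennreal (1 / p * norm (A x - yd) powr p) + ennreal \<alpha> * l1_norm u x"

text \<open>Functions on \<open>(0,\<infinity>)\<close>; values at non-positive arguments are irrelevant.\<close>
definition index_function :: "(real \<Rightarrow> real) \<Rightarrow> bool"
  where "index_function \<phi> \<longleftrightarrow>
    (\<forall>t>0. \<phi> t > 0) \<and> mono_on {0<..} \<phi> \<and> (\<phi> \<longlongrightarrow> 0) (at_right 0)"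

end

theory Submission
  imports Defs
begin

text \<open>
  For \<open>k \<in> supp x\<^sup>\<dagger>\<close> write \<open>u\<^sub>k = \<E> v\<^sub>k\<close>; then
  \<open>\<bar>\<langle>x - x\<^sup>\<dagger>, u\<^sub>k\<rangle>\<bar> \<le> K\<^sup>-\<^sup>1 \<parallel>v\<^sub>k\<parallel> \<parallel>A (x - x\<^sup>\<dagger>)\<parallel>\<close>. Coefficients outside the support
  cost nothing in \<open>\<parallel>x - x\<^sup>\<dagger>\<parallel>\<^sub>1 - \<parallel>x\<parallel>\<^sub>1 + \<parallel>x\<^sup>\<dagger>\<parallel>\<^sub>1\<close>, so splitting the sum at an arbitrary index yields
  the variational inequality
  \<open>\<parallel>x - x\<^sup>\<dagger>\<parallel>\<^sub>1 \<le> \<parallel>x\<parallel>\<^sub>1 - \<parallel>x\<^sup>\<dagger>\<parallel>\<^sub>1 + \<phi> \<parallel>A (x - x\<^sup>\<dagger>)\<parallel>\<close> with \<open>\<phi>\<close> an infimum of affine functions.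
  With \<open>\<alpha> = \<delta>\<^sup>p / \<phi> \<delta>\<close> and \<open>s = \<parallel>A x - y\<^sup>\<delta>\<parallel> / \<delta>\<close>, the minimizing property together with
  \<open>\<phi> ((1 + s) \<delta>) \<le> (1 + s) \<phi> \<delta>\<close> bounds the error by \<open>(1/p - s\<^sup>p/p + 1 + s) \<phi> \<delta>\<close>,
  which is at most \<open>2 \<phi> \<delta>\<close> by Young's inequality.
\<close>

section \<open>Infima of affine functions as concave index functions\<close>

definition affine_INF :: "(nat \<Rightarrow> real) \<Rightarrow> (nat \<Rightarrow> real) \<Rightarrow> real \<Rightarrow> real"
  where "affine_INF a b t = (INF n. a n + b n * t)"

lemma affine_INF_lower:
  assumes "\<And>n. a n \<ge> 0" "\<And>n. b n \<ge> 0" "t \<ge> 0"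
  shows "affine_INF a b t \<le> a n + b n * t"
  unfolding affine_INF_def
proof (rule cINF_lower)
  show "bdd_below (range (\<lambda>n. a n + b n * t))"
    by (rule bdd_belowI[of _ 0]) (use assms in auto)
qed simp

lemma affine_INF_greatest:
  assumes "\<And>n. m \<le> a n + b n * t"
  shows "m \<le> affine_INF a b t"
  unfolding affine_INF_def using assms by (intro cINF_greatest) auto

lemma affine_INF_mono:
  assumes "\<And>n. a n \<ge> 0" "\<And>n. b n \<ge> 0" "0 \<le> s" "s \<le> t"
  shows "affine_INF a b s \<le> affine_INF a b t"
proof (rule affine_INF_greatest)
  fix n
  show "affine_INF a b s \<le> a n + b n * t"
    using affine_INF_lower[of a b s n] mult_left_mono[OF assms(4,2), of n] assms by auto
qed

text \<open>Replacing \<open>t\<close> by \<open>c * t\<close> multiplies only the slope term; as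
  \<open>a n\<close> is nonnegative and \<open>c\<close> is at least 1, multiplying the intercept by
  \<open>c\<close> as well can only enlarge each affine function.\<close>

lemma affine_INF_scale:
  assumes "\<And>n. a n \<ge> 0" "\<And>n. b n \<ge> 0" "c \<ge> 1" "t \<ge> 0"
  shows "affine_INF a b (c * t) \<le> c * affine_INF a b t"
proof -
  have "affine_INF a b (c * t) / c \<le> affine_INF a b t"
  proof (rule affine_INF_greatest)
    fix n
    have "affine_INF a b (c * t) \<le> a n + b n * (c * t)"
      using assms by (intro affine_INF_lower) auto
    also have "\<dots> \<le> c * a n + b n * (c * t)"
      using mult_right_mono[OF assms(3) assms(1)[of n]] by simp
    finally show "affine_INF a b (c * t) / c \<le> a n + b n * t"
      using assms(3) by (simp add: field_simps)
  qed
  then show ?thesis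
    using assms(3) by (simp add: field_simps)
qed

lemma affine_INF_concave:
  assumes "\<And>n. a n \<ge> 0" "\<And>n. b n \<ge> 0"
  shows "concave_on {0<..} (affine_INF a b)"
  unfolding concave_on_iff
proof (intro conjI ballI allI impI affine_INF_greatest)
  fix x y \<mu> \<nu> :: real and n
  assume *: "x \<in> {0<..}" "y \<in> {0<..}" "\<mu> \<ge> 0" "\<nu> \<ge> 0" "\<mu> + \<nu> = 1"
  have "\<mu> * affine_INF a b x + \<nu> * affine_INF a b y
      \<le> \<mu> * (a n + b n * x) + \<nu> * (a n + b n * y)"
    using * assms by (intro add_mono mult_left_mono affine_INF_lower) auto
  also have "\<dots> = (\<mu> + \<nu>) * a n + b n * (\<mu> * x + \<nu> * y)"
    by (simp add: algebra_simps)
  finally show "\<mu> * affine_INF a b x + \<nu> * affine_INF a b y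
      \<le> a n + b n * (\<mu> *\<^sub>R x + \<nu> *\<^sub>R y)"
    using * by simp
qed (rule convex_real_interval)

text \<open>The uniform slope bound \<open>b0\<close> keeps the infimum above \<open>b0 * t\<close>,
  hence positive, while the vanishing intercepts force it to 0 at 0.\<close>

lemma affine_INF_index_function:
  assumes a: "\<And>n. a n \<ge> 0" "a \<longlonglongrightarrow> 0" and b: "\<And>n. b n \<ge> b0" "b0 > 0"
  shows "index_function (affine_INF a b)"
  unfolding index_function_def
proof (intro conjI allI impI)
  have b_nonneg: "b n \<ge> 0" for n
    using b(1)[of n] b(2) by linarith
  have ge: "b0 * t \<le> affine_INF a b t" if "t > 0" for t
  proof (rule affine_INF_greatest)
    show "b0 * t \<le> a n + b n * t" for n
      using add_mono[OF a(1)[of n] mult_right_mono[OF b(1)[of n] less_imp_le[OF that]]] by simp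
  qed
  show "affine_INF a b t > 0" if "t > 0" for t
    using ge[OF that] mult_pos_pos[OF b(2) that] by linarith
  show "mono_on {0<..} (affine_INF a b)"
    using a(1) b_nonneg by (intro mono_onI affine_INF_mono) auto
  show "(affine_INF a b \<longlongrightarrow> 0) (at_right 0)"
  proof (rule order_tendstoI)
    fix e :: real assume "e < 0"
    show "\<forall>\<^sub>F t in at_right 0. e < affine_INF a b t"
      using eventually_at_right_less
    proof eventually_elim
      case (elim t)
      then show ?case
        using ge[of t] mult_pos_pos[OF b(2), of t] \<open>e < 0\<close> by simp
    qed
  next
    fix e :: real assume "e > 0"
    then have "\<forall>\<^sub>F n in sequentially. a n < e"
      using order_tendstoD(2)[OF a(2)] by simp
    \<comment> \<open>\<open>n\<close> is fixed before \<open>t\<close> tends to 0. Only this one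
      affine function is used, so the slopes may be unbounded in \<open>n\<close>.\<close>
    then obtain n where n: "a n < e"
      using eventually_happens'[OF sequentially_bot] by blast
    have "((\<lambda>t. a n + b n * t) \<longlongrightarrow> a n + b n * 0) (at_right 0)"
      by (intro tendsto_intros)
    then have "\<forall>\<^sub>F t in at_right 0. a n + b n * t < e"
      using order_tendstoD(2) n by fastforce
    then show "\<forall>\<^sub>F t in at_right 0. affine_INF a b t < e"
      using eventually_at_right_less
    proof eventually_elim
      case (elim t)
      then show ?case
        using affine_INF_lower[of a b t n, OF a(1) b_nonneg] by linarith
    qed
  qed
qed

section \<open>Comparison of the l1 distance with the difference of the l1 norms\<close>

lemma l1_distance_le:
  fixes f g M :: "nat \<Rightarrow> real"
  assumes f: "summable (\<lambda>k. \<bar>f k\<bar>)" and g: "summable (\<lambda>k. \<bar>g k\<bar>)"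
    and M: "\<And>k. M k * D \<ge> 0" "\<And>k. f k \<noteq> 0 \<Longrightarrow> \<bar>g k - f k\<bar> \<le> M k * D"
  shows "summable (\<lambda>k. \<bar>g k - f k\<bar>)"
    and "(\<Sum>k. \<bar>g k - f k\<bar>) \<le> (\<Sum>k. \<bar>g k\<bar>) - (\<Sum>k. \<bar>f k\<bar>)
      + (2 * (\<Sum>k. \<bar>f (k + n)\<bar>) + 2 * (\<Sum>k<n. M k) * D)"
proof -
  show d: "summable (\<lambda>k. \<bar>g k - f k\<bar>)"
    by (rule summable_comparison_test'[OF summable_add[OF g f], of 0]) auto
  \<comment> \<open>\<open>e\<close> dominates
    \<open>\<bar>g k - f k\<bar> - \<bar>g k\<bar> + \<bar>f k\<bar>\<close>. By the triangle
    inequality this is at most \<open>2 * \<bar>g k - f k\<bar>\<close>, used for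
    \<open>k < n\<close>, and at most \<open>2 * \<bar>f k\<bar>\<close>, used in the tail. It
    vanishes where \<open>f k = 0\<close>, so no bound on \<open>g k\<close> is needed
    there.\<close>
  define e where "e k = (if k < n then 2 * (M k * D) else 2 * \<bar>f k\<bar>)" for k
  have tail: "summable (\<lambda>k. \<bar>f (k + n)\<bar>)"
    using f by (subst summable_iff_shift)
  have "summable (\<lambda>k. e (k + n))"
    unfolding e_def using summable_mult[OF tail, of 2] by simp
  then have e: "summable e"
    by (subst (asm) summable_iff_shift)
  have "suminf e = (\<Sum>k. e (k + n)) + (\<Sum>k<n. e k)"
    by (rule suminf_split_initial_segment[OF e])
  also have "\<dots> = 2 * (\<Sum>k. \<bar>f (k + n)\<bar>) + 2 * (\<Sum>k<n. M k) * D"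
    unfolding e_def using suminf_mult[OF tail, of 2]
    by (simp add: sum_distrib_left sum_distrib_right mult.assoc)
  finally have sum_e: "suminf e = \<dots>" .
  have "\<bar>g k - f k\<bar> \<le> \<bar>g k\<bar> - \<bar>f k\<bar> + e k" for k
    using M[of k] by (cases "f k = 0") (auto simp: e_def)
  then have "(\<Sum>k. \<bar>g k - f k\<bar>) \<le> (\<Sum>k. \<bar>g k\<bar> - \<bar>f k\<bar> + e k)"
    by (intro suminf_le d summable_add summable_diff e f g)
  also have "\<dots> = (\<Sum>k. \<bar>g k\<bar>) - (\<Sum>k. \<bar>f k\<bar>) + suminf e"
    using suminf_add[OF summable_diff[OF g f] e] suminf_diff[OF g f] by simp
  finally show "(\<Sum>k. \<bar>g k - f k\<bar>) \<le> (\<Sum>k. \<bar>g k\<bar>) - (\<Sum>k. \<bar>f k\<bar>)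
      + (2 * (\<Sum>k. \<bar>f (k + n)\<bar>) + 2 * (\<Sum>k<n. M k) * D)"
    unfolding sum_e .
qed

section \<open>Real-valued form of the functional and the variational inequality\<close>

lemma summable_if_l1_norm_finite:
  assumes "l1_norm u x < \<infinity>"
  shows "summable (\<lambda>k. \<bar>x \<bullet> u k\<bar>)"
  using assms unfolding l1_norm_def by (intro summable_suminf_not_top) auto

lemma l1_norm_eq_ennreal:
  assumes "summable (\<lambda>k. \<bar>x \<bullet> u k\<bar>)"
  shows "l1_norm u x = ennreal (\<Sum>k. \<bar>x \<bullet> u k\<bar>)"
  unfolding l1_norm_def using assms by (intro suminf_ennreal2) auto

lemma tikhonov_eq_ennreal:
  assumes "summable (\<lambda>k. \<bar>x \<bullet> u k\<bar>)" "\<alpha> > 0" "p > 0"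
  shows "tikhonov A u p \<alpha> yd x
    = ennreal (1 / p * norm (A x - yd) powr p + \<alpha> * (\<Sum>k. \<bar>x \<bullet> u k\<bar>))"
  using assms by (simp add: tikhonov_def l1_norm_eq_ennreal suminf_nonneg flip: ennreal_mult ennreal_plus)

text \<open>The last property accepts any bound \<open>t\<close> on the residual, so a
  triangle-inequality estimate can be inserted directly; the scaling property then reduces it to the
  noise level.\<close>

lemma variational_source_condition:
  fixes A :: "'x::real_inner \<Rightarrow> 'y::real_normed_vector"
  assumes A: "bounded_linear A"
    and E_adj: "\<And>x v. blinfun_apply (E_adj x) v = x \<bullet> E v"
    and K: "K > 0" "\<And>x. norm (A x) \<ge> K * norm (E_adj x)"
    and u_in_V: "\<And>k. k \<in> supp u xdag \<Longrightarrow> u k \<in> range E"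
    and xdag: "summable (\<lambda>k. \<bar>xdag \<bullet> u k\<bar>)"
  obtains \<phi> :: "real \<Rightarrow> real" where
    "index_function \<phi>" "concave_on {0<..} \<phi>"
    "\<And>c t. c \<ge> 1 \<Longrightarrow> t \<ge> 0 \<Longrightarrow> \<phi> (c * t) \<le> c * \<phi> t"
    "\<And>x t. summable (\<lambda>k. \<bar>x \<bullet> u k\<bar>) \<Longrightarrow> norm (A x - A xdag) \<le> t \<Longrightarrow>
      summable (\<lambda>k. \<bar>(x - xdag) \<bullet> u k\<bar>) \<and>
      (\<Sum>k. \<bar>(x - xdag) \<bullet> u k\<bar>) \<le> (\<Sum>k. \<bar>x \<bullet> u k\<bar>) - (\<Sum>k. \<bar>xdag \<bullet> u k\<bar>) + \<phi> t"
proof -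
  define M where
    "M k = (if k \<in> supp u xdag then norm (inv_into UNIV E (u k)) / K else 0)" for k
  define a where "a n = 2 * (\<Sum>k. \<bar>xdag \<bullet> u (k + n)\<bar>)" for n
  \<comment> \<open>The summand 1 keeps \<open>\<phi>\<close> positive when \<open>xdag\<close> has finite support.\<close>
  define b where "b n = 2 * (\<Sum>k<n. M k) + 1" for n
  have M_nonneg: "M k \<ge> 0" for k
    using K(1) by (simp add: M_def)
  have a_nonneg: "a n \<ge> 0" for n
    using summable_ignore_initial_segment[OF xdag, of n] by (simp add: a_def suminf_nonneg)
  have b_ge: "b n \<ge> 1" for n
    using sum_nonneg[of "{..<n}" M] M_nonneg by (simp add: b_def)
  then have b_nonneg: "b n \<ge> 0" for n
    using order_trans[of 0 1 "b n"] by simp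
  have "(\<lambda>n. \<Sum>k. \<bar>xdag \<bullet> u (k + n)\<bar>) \<longlonglongrightarrow> 0"
    using suminf_exist_split[OF _ xdag] by (intro LIMSEQ_I) auto
  then have a_lim: "a \<longlonglongrightarrow> 0"
    unfolding a_def by (rule tendsto_mult_right_zero)
  show thesis
  proof (rule that[of "affine_INF a b"])
    show "index_function (affine_INF a b)"
      using affine_INF_index_function[of a 1 b] a_nonneg a_lim b_ge by simp
    show "concave_on {0<..} (affine_INF a b)"
      using a_nonneg b_nonneg by (rule affine_INF_concave)
    show "affine_INF a b (c * t) \<le> c * affine_INF a b t" if "c \<ge> 1" "t \<ge> 0" for c t
      using a_nonneg b_nonneg that by (rule affine_INF_scale)
  next
    fix x t
    assume x: "summable (\<lambda>k. \<bar>x \<bullet> u k\<bar>)" and t: "norm (A x - A xdag) \<le> t"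
    have t_nonneg: "t \<ge> 0"
      using norm_ge_zero t by (rule order_trans)
    have coeff: "\<bar>x \<bullet> u k - xdag \<bullet> u k\<bar> \<le> M k * t" if "xdag \<bullet> u k \<noteq> 0" for k
    proof -
      have k: "k \<in> supp u xdag"
        using that by (simp add: supp_def)
      define v where "v = inv_into UNIV E (u k)"
      have v: "E v = u k"
        unfolding v_def by (rule f_inv_into_f[OF u_in_V[OF k]])
      \<comment> \<open>Because \<open>u k\<close> lies in the range of \<open>E\<close>, the
        coefficient is a duality pairing, so the weak dual norm, which \<open>K\<close> controls
        through \<open>A\<close>, suffices to bound it.\<close>
      have "\<bar>x \<bullet> u k - xdag \<bullet> u k\<bar> = norm (blinfun_apply (E_adj (x - xdag)) v)"
        by (simp add: E_adj v inner_diff_left)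
      also have "\<dots> \<le> norm (E_adj (x - xdag)) * norm v"
        by (rule norm_blinfun)
      also have "\<dots> \<le> (t / K) * norm v"
      proof (rule mult_right_mono)
        have "K * norm (E_adj (x - xdag)) \<le> norm (A (x - xdag))"
          by (rule K(2))
        also have "\<dots> \<le> t"
          using t by (simp add: linear_diff[OF bounded_linear.linear[OF A]])
        finally show "norm (E_adj (x - xdag)) \<le> t / K"
          using K(1) by (simp add: field_simps)
      qed simp
      finally show ?thesis
        using k by (simp add: M_def v_def mult.commute)
    qed
    have Mt: "M k * t \<ge> 0" for k
      using M_nonneg t_nonneg by simp
    note bound = l1_distance_le[of "\<lambda>k. xdag \<bullet> u k" "\<lambda>k. x \<bullet> u k" M t, OF xdag x Mt coeff]
    \<comment> \<open>The left-hand side does not depend on the splitting index, so the bounds for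
      all \<open>n\<close> combine into the infimum.\<close>
    have "(\<Sum>k. \<bar>x \<bullet> u k - xdag \<bullet> u k\<bar>) - ((\<Sum>k. \<bar>x \<bullet> u k\<bar>) - (\<Sum>k. \<bar>xdag \<bullet> u k\<bar>))
        \<le> affine_INF a b t"
    proof (rule affine_INF_greatest)
      fix n
      show "(\<Sum>k. \<bar>x \<bullet> u k - xdag \<bullet> u k\<bar>) - ((\<Sum>k. \<bar>x \<bullet> u k\<bar>) - (\<Sum>k. \<bar>xdag \<bullet> u k\<bar>))
          \<le> a n + b n * t"
        using bound(2)[of n] t_nonneg by (simp add: a_def b_def distrib_right)
    qed
    with bound(1) show "summable (\<lambda>k. \<bar>(x - xdag) \<bullet> u k\<bar>) \<and>
      (\<Sum>k. \<bar>(x - xdag) \<bullet> u k\<bar>)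
        \<le> (\<Sum>k. \<bar>x \<bullet> u k\<bar>) - (\<Sum>k. \<bar>xdag \<bullet> u k\<bar>) + affine_INF a b t"
      by (simp add: inner_diff_left)
  qed
qed

section \<open>Parameter choice and convergence rate\<close>

lemma le_powr_div_add:
  fixes s p :: real
  assumes "p > 1" "s \<ge> 0"
  shows "s \<le> s powr p / p + (1 - 1 / p)"
proof -
  \<comment> \<open>The conjugate exponent of \<open>p\<close>: in Young's inequality for
    \<open>s * 1\<close>, the factor 1 contributes \<open>1 / q\<close>.\<close>
  define q where "q = p / (p - 1)"
  have "q > 1" "1 / q = 1 - 1 / p"
    using assms(1) by (auto simp: q_def field_simps)
  with Youngs_inequality[of p q s 1] assms show ?thesis
    by simp
qed

theorem theorem5:
  fixes A :: "'x::{real_inner,complete_space} \<Rightarrow> 'y::banach"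
    and E :: "'v::real_normed_vector \<Rightarrow> 'x"
    and E_adj :: "'x \<Rightarrow> 'v \<Rightarrow>\<^sub>L real"
    and u :: "nat \<Rightarrow> 'x"
    and xdag :: 'x and y :: 'y
    and K p :: real
  assumes infinite_dim: "\<not> (\<exists>B :: 'x set. finite B \<and> span B = UNIV)"
    and separable: "separable_space (euclidean :: 'x topology)"
    and A: "bounded_linear A" "inj A" "\<not> closed (range A)"
    and gelfand: "gelfand_triple E E_adj"
    and K: "K > 0" "\<And>x. norm (A x) \<ge> K * norm (E_adj x)"
    and p: "p > 1"
    and y: "y \<in> range A"
    and xdag: "A xdag = y"
    and u: "orthonormal_basis u"
    and u_in_V: "\<And>k. k \<in> supp u xdag \<Longrightarrow> u k \<in> range E"
    and xdag_l1: "l1_norm u xdag < \<infinity>"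
  shows "\<exists>(\<alpha> :: real \<Rightarrow> 'y \<Rightarrow> real) (\<phi> :: real \<Rightarrow> real).
           (\<forall>\<delta>>0. \<forall>yd. \<alpha> \<delta> yd > 0) \<and>
           index_function \<phi> \<and> concave_on {0<..} \<phi> \<and>
           (\<exists>C>0. \<exists>\<delta>bar>0. \<forall>\<delta> yd x.
              0 < \<delta> \<longrightarrow> \<delta> \<le> \<delta>bar \<longrightarrow> norm (y - yd) \<le> \<delta> \<longrightarrow>
              is_arg_min (tikhonov A u p (\<alpha> \<delta> yd) yd) (\<lambda>_. True) x \<longrightarrow>
              l1_norm u (x - xdag) \<le> ennreal (C * \<phi> \<delta>))"
proof -
  from gelfand have E_adj: "blinfun_apply (E_adj x) v = x \<bullet> E v" for x v
    by (simp add: gelfand_triple_def)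
  note xdag_sum = summable_if_l1_norm_finite[OF xdag_l1]
  obtain \<phi> where \<phi>: "index_function \<phi>" "concave_on {0<..} \<phi>"
    "\<And>c t. c \<ge> 1 \<Longrightarrow> t \<ge> 0 \<Longrightarrow> \<phi> (c * t) \<le> c * \<phi> t"
    and vsc: "\<And>x t. summable (\<lambda>k. \<bar>x \<bullet> u k\<bar>) \<Longrightarrow> norm (A x - A xdag) \<le> t \<Longrightarrow>
      summable (\<lambda>k. \<bar>(x - xdag) \<bullet> u k\<bar>) \<and>
      (\<Sum>k. \<bar>(x - xdag) \<bullet> u k\<bar>) \<le> (\<Sum>k. \<bar>x \<bullet> u k\<bar>) - (\<Sum>k. \<bar>xdag \<bullet> u k\<bar>) + \<phi> t"
    by (rule variational_source_condition[OF A(1) E_adj K _ xdag_sum])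
      (rule u_in_V, assumption, rule that)
  have \<phi>_pos: "\<phi> t > 0" if "t > 0" for t
    using \<phi>(1) that by (simp add: index_function_def)
  \<comment> \<open>An a priori choice, independent of \<open>yd\<close>: dividing the data error
    \<open>\<delta> powr p / p\<close> by \<alpha> leaves \<open>\<phi> \<delta> / p\<close>, the
    order of the desired rate.\<close>
  define \<alpha> :: "real \<Rightarrow> 'y \<Rightarrow> real" where "\<alpha> \<delta> yd = \<delta> powr p / \<phi> \<delta>" for \<delta> yd
  have \<alpha>_pos: "\<alpha> \<delta> yd > 0" if "\<delta> > 0" for \<delta> yd
    using \<phi>_pos that by (simp add: \<alpha>_def)
  have bound: "l1_norm u (x - xdag) \<le> ennreal (2 * \<phi> \<delta>)"
    if \<delta>: "0 < \<delta>" "norm (y - yd) \<le> \<delta>"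
      and min: "is_arg_min (tikhonov A u p (\<alpha> \<delta> yd) yd) (\<lambda>_. True) x" for \<delta> yd x
  proof -
    have T_le: "tikhonov A u p (\<alpha> \<delta> yd) yd x \<le> tikhonov A u p (\<alpha> \<delta> yd) yd xdag"
      using min by (auto simp: is_arg_min_def not_less)
    also have T_xdag: "\<dots> = ennreal (1 / p * norm (A xdag - yd) powr p
        + \<alpha> \<delta> yd * (\<Sum>k. \<bar>xdag \<bullet> u k\<bar>))"
      using xdag_sum \<alpha>_pos[OF \<delta>(1)] p by (intro tikhonov_eq_ennreal) auto
    also have "\<dots> < \<infinity>"
      by simp
    \<comment> \<open>Minimality against \<open>xdag\<close>, where the functional is finite,
      excludes a divergent series for \<open>x\<close>; from here on real arithmetic
      applies.\<close>
    finally have "ennreal (\<alpha> \<delta> yd) * l1_norm u x < \<infinity>"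
      unfolding tikhonov_def by (simp add: less_top[symmetric])
    then have "l1_norm u x < \<infinity>"
      using \<alpha>_pos[OF \<delta>(1), of yd] by (auto simp: ennreal_mult_less_top)
    note x_sum = summable_if_l1_norm_finite[OF this]
    \<comment> \<open>The residual in units of the noise level. No bound on \<open>s\<close> is
      proved: its linear growth through \<open>\<phi>\<close> is absorbed by
      \<open>- s powr p / p\<close>.\<close>
    define s where "s = norm (A x - yd) / \<delta>"
    have s: "s \<ge> 0" "norm (A x - yd) = s * \<delta>"
      using \<delta>(1) by (auto simp: s_def)
    have T_x: "tikhonov A u p (\<alpha> \<delta> yd) yd x = ennreal (1 / p * norm (A x - yd) powr p
        + \<alpha> \<delta> yd * (\<Sum>k. \<bar>x \<bullet> u k\<bar>))"
      using x_sum \<alpha>_pos[OF \<delta>(1)] p by (intro tikhonov_eq_ennreal) auto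
    have "1 / p * norm (A xdag - yd) powr p + \<alpha> \<delta> yd * (\<Sum>k. \<bar>xdag \<bullet> u k\<bar>) \<ge> 0"
      using p \<alpha>_pos[OF \<delta>(1), of yd] suminf_nonneg[OF xdag_sum] by simp
    from T_le[unfolded T_x T_xdag ennreal_le_iff[OF this]]
    have "1 / p * norm (A x - yd) powr p + \<alpha> \<delta> yd * (\<Sum>k. \<bar>x \<bullet> u k\<bar>)
        \<le> 1 / p * norm (A xdag - yd) powr p + \<alpha> \<delta> yd * (\<Sum>k. \<bar>xdag \<bullet> u k\<bar>)" .
    moreover have "norm (A xdag - yd) powr p \<le> \<delta> powr p"
      using \<delta> p by (intro powr_mono2) (auto simp: xdag)
    ultimately have "\<alpha> \<delta> yd * ((\<Sum>k. \<bar>x \<bullet> u k\<bar>) - (\<Sum>k. \<bar>xdag \<bullet> u k\<bar>))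
        \<le> \<delta> powr p * (1 / p - s powr p / p)"
      using mult_left_mono[of "norm (A xdag - yd) powr p" "\<delta> powr p" "1 / p"] s(1) \<delta>(1) p
      unfolding s(2) by (simp add: powr_mult algebra_simps)
    then have "(\<Sum>k. \<bar>x \<bullet> u k\<bar>) - (\<Sum>k. \<bar>xdag \<bullet> u k\<bar>) \<le> (1 / p - s powr p / p) * \<phi> \<delta>"
      using \<delta>(1) \<phi>_pos[OF \<delta>(1)]
      by (simp add: \<alpha>_def pos_divide_le_eq mult.assoc mult_le_cancel_left_pos)
    moreover have "norm (A x - A xdag) \<le> (1 + s) * \<delta>"
      using norm_triangle_ineq2[of "A x - yd" "A xdag - yd"] norm_triangle_ineq[of "A x - yd" "yd - y"]
        \<delta>(2) s(2) by (simp add: xdag norm_minus_commute distrib_right)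
    note vsc[OF x_sum this]
    moreover have "\<phi> ((1 + s) * \<delta>) \<le> (1 + s) * \<phi> \<delta>"
      using s(1) \<delta>(1) by (intro \<phi>(3)) auto
    ultimately have le: "(\<Sum>k. \<bar>(x - xdag) \<bullet> u k\<bar>) \<le> (1 / p - s powr p / p + (1 + s)) * \<phi> \<delta>"
      and sum: "summable (\<lambda>k. \<bar>(x - xdag) \<bullet> u k\<bar>)"
      unfolding distrib_right[of _ "1 + s"] by auto
    note le
    \<comment> \<open>Young's bound on \<open>s\<close> cancels both \<open>s powr p / p\<close> and
      \<open>1 / p\<close>, leaving exactly 2.\<close>
    also have "(1 / p - s powr p / p + (1 + s)) * \<phi> \<delta> \<le> 2 * \<phi> \<delta>"
      using le_powr_div_add[OF p s(1)] \<phi>_pos[OF \<delta>(1)] by (intro mult_right_mono) auto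
    finally show ?thesis
      using l1_norm_eq_ennreal[OF sum] by (simp add: ennreal_leI)
  qed
  show ?thesis
  proof (intro exI conjI)
    show "\<forall>\<delta>>0. \<forall>yd. \<alpha> \<delta> yd > 0"
      using \<alpha>_pos by blast
    show "index_function \<phi>" "concave_on {0<..} \<phi>"
      by fact+
    \<comment> \<open>The threshold 1 is arbitrary, since \<open>bound\<close> holds for every
      positive \<delta>.\<close>
    show "(2::real) > 0" "(1::real) > 0"
      by simp_all
    show "\<forall>\<delta> yd x. 0 < \<delta> \<longrightarrow> \<delta> \<le> 1 \<longrightarrow> norm (y - yd) \<le> \<delta> \<longrightarrow>
        is_arg_min (tikhonov A u p (\<alpha> \<delta> yd) yd) (\<lambda>_. True) x \<longrightarrow>
        l1_norm u (x - xdag) \<le> ennreal (2 * \<phi> \<delta>)"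
      using bound by blast
  qed
qed

end
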